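(* Let $\mathfrak{J}=(x_1f:\cdots:x_nf:g)$ be a generalized de Jonquières map of $\mathbb{P}^n$ $(n\ge 2)$ of degree $d\ge 2$ with identity support, and let $F_{d-2}$ be the last term, of bidegree $(1,d-1)$, of a fully downgraded sequence $\{F_0,F_1,\ldots,F_{d-2}\}$ associated to it. Then the inverse map of $\mathfrak{J}$ is defined by the forms $$\frac{\partial F_{d-2}}{\partial x_{n+1}}\,y_1,\ \ldots,\ \frac{\partial F_{d-2}}{\partial x_{n+1}}\,y_n,\ \sum_{i=1}^n\frac{\partial F_{d-2}}{\partial x_i}\,y_i .$$ In particular, the inverse map is a generalized de Jonquières map of degree $d$ with identity support.
   Context: $k$ is an infinite field, $R=k[x_1,\ldots,x_{n+1}]$. The source of $\mathfrak{J}$ is $\mathrm{Proj}(k[x_1,\ldots,x_{n+1}])$ and the target is $\mathrm{Proj}(k[y_1,\ldots,y_{n+1}])$. A polynomial is an $x_{n+1}$-monoid if its degree in $x_{n+1}$ is at most $1$. A generalized de Jonquières map of degree $d\ge2$ with identity support is a Cremona transformation $\mathfrak{J}=(x_1f:\cdots:x_nf:g)$ of $\mathbb{P}^n$, where $f,g\in R$ are forms of degrees $d-1$ and $d$ with $\gcd(f,g)=1$, both $x_{n+1}$-monoids, at least one of which involves $x_{n+1}$ effectively (then $g\in(x_1,\ldots,x_n)R$). The same definition applies to the inverse, with the $y$-variables in place of the $x$-variables. Fully downgraded sequence. Write $g=q_1x_1+\cdots+q_nx_n$ with $q_1,\ldots,q_n\in R$ forms of degree $d-1$ that are $x_{n+1}$-monoids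 (so $f,q_1,\ldots,q_n\in(x_1,\ldots,x_n)^{d-2}R$) and set $F_0:=f\,y_{n+1}-\sum_{i=1}^n q_iy_i\in R[y_1,\ldots,y_{n+1}]$, which is bihomogeneous of bidegree $(d-1,1)$ in (the $x$-variables, the $y$-variables). Inductively, for $0\le i\le d-3$, the form $F_i$ has bidegree $(d-1-i,i+1)$ and lies in $(x_1,\ldots,x_n)^{d-2-i}R[y_1,\ldots,y_{n+1}]$; write $F_i=F_{i,1}x_1+\cdots+F_{i,n}x_n$ with $F_{i,j}$ bihomogeneous of bidegree $(d-2-i,i+1)$ in $(x_1,\ldots,x_n)^{d-3-i}R[y_1,\ldots,y_{n+1}]$, and set $F_{i+1}:=F_{i,1}y_1+\cdots+F_{i,n}y_n$. Any $\{F_0,\ldots,F_{d-2}\}$ obtained in this way is a fully downgraded sequence associated to $\mathfrak{J}$.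
   Formalization: The last form of the inverse is taken with a minus sign, −∑ (∂F_{d-2}/∂x_i) y_i; as printed the claim fails in characteristic ≠ 2, e.g. for (x_1x_3 : x_2x_3 : x_1²) with F_0 = x_3y_3 − x_1y_1, whose inverse is (y_1y_3 : y_2y_3 : y_1²). *)

theory Defs
  imports Complex_Main "HOL-Library.Poly_Mapping" "HOL-Library.Cardinality"
begin

(* Polynomials with coefficients in 'a and variables indexed by 'v: a finitely supported
   map from monomials (exponent vectors) to coefficients.

   Throughout, the n + 1 projective coordinates are indexed by 'n option with 'n a finite
   type of n elements: Some j stands for one of the first n coordinates, None for the
   (n+1)-st.  Thus R = k[x_1,...,x_{n+1}] is ('n option, 'k) mpoly, and so is
   k[y_1,...,y_{n+1}], while R[y_1,...,y_{n+1}] is ('n option, ('n option, 'k) mpoly) mpoly. *)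
type_synonym ('v, 'a) mpoly = "('v \<Rightarrow>\<^sub>0 nat) \<Rightarrow>\<^sub>0 'a"

definition pvar :: "'v \<Rightarrow> ('v, 'a::comm_ring_1) mpoly" where
  "pvar v = Poly_Mapping.single (Poly_Mapping.single v 1) 1"

definition pconst :: "'a::comm_ring_1 \<Rightarrow> ('v, 'a) mpoly" where
  "pconst c = Poly_Mapping.single 0 c"

definition mdeg :: "('v \<Rightarrow>\<^sub>0 nat) \<Rightarrow> nat" where
  "mdeg m = (\<Sum>v\<in>Poly_Mapping.keys m. Poly_Mapping.lookup m v)"

(* As usual, 0 is a form of every degree. *)
definition form :: "nat \<Rightarrow> ('v, 'a::comm_ring_1) mpoly \<Rightarrow> bool" where
  "form d p \<longleftrightarrow> (\<forall>m\<in>Poly_Mapping.keys p. mdeg m = d)"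

(* p is a v-monoid: its degree in the variable v is at most 1. *)
definition monoidal :: "'v \<Rightarrow> ('v, 'a::comm_ring_1) mpoly \<Rightarrow> bool" where
  "monoidal v p \<longleftrightarrow> (\<forall>m\<in>Poly_Mapping.keys p. Poly_Mapping.lookup m v \<le> 1)"

definition involves :: "'v \<Rightarrow> ('v, 'a::comm_ring_1) mpoly \<Rightarrow> bool" where
  "involves v p \<longleftrightarrow> (\<exists>m\<in>Poly_Mapping.keys p. Poly_Mapping.lookup m v \<noteq> 0)"

(* gcd(f,g) = 1; the library constant coprime is not available, because it requires a
   division operation on the ring. *)
definition gcd_one :: "'a::comm_ring_1 \<Rightarrow> 'a \<Rightarrow> bool" where
  "gcd_one f g \<longleftrightarrow> (\<forall>c. c dvd f \<longrightarrow> c dvd g \<longrightarrow> c dvd 1)"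

definition partial :: "'v \<Rightarrow> ('v, 'a::comm_ring_1) mpoly \<Rightarrow> ('v, 'a) mpoly" where
  "partial v p = (\<Sum>m\<in>Poly_Mapping.keys p.
     Poly_Mapping.single (m - Poly_Mapping.single v 1)
       (of_nat (Poly_Mapping.lookup m v) * Poly_Mapping.lookup p m))"

(* The polynomial p(T) obtained by substituting T v for each variable v. *)
definition psubst :: "('v \<Rightarrow> ('w, 'a::comm_ring_1) mpoly) \<Rightarrow> ('v, 'a) mpoly \<Rightarrow> ('w, 'a) mpoly" where
  "psubst T p = (\<Sum>m\<in>Poly_Mapping.keys p.
     pconst (Poly_Mapping.lookup p m) *
       (\<Prod>v\<in>Poly_Mapping.keys m. T v ^ Poly_Mapping.lookup m v))"


(* A rational map between projective spaces over an infinite field is represented by a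
   tuple of forms of one common degree, not all zero (common factors are allowed). *)
definition rational_map :: "('v \<Rightarrow> ('w, 'k::field) mpoly) \<Rightarrow> bool" where
  "rational_map T \<longleftrightarrow> (\<exists>d. \<forall>v. form d (T v)) \<and> (\<exists>v. T v \<noteq> 0)"

(* Two tuples represent the same rational map iff they are proportional, i.e. all the
   2 x 2 minors vanish. *)
definition same_rational_map ::
    "('v \<Rightarrow> ('w, 'k::field) mpoly) \<Rightarrow> ('v \<Rightarrow> ('w, 'k) mpoly) \<Rightarrow> bool" where
  "same_rational_map S T \<longleftrightarrow> rational_map S \<and> rational_map T \<and>
     (\<forall>u v. S u * T v = S v * T u)"

definition compose_map :: "('u \<Rightarrow> ('v, 'k::field) mpoly) \<Rightarrow> ('v \<Rightarrow> ('w, 'k) mpoly) \<Rightarrow> 'u \<Rightarrow> ('w, 'k) mpoly" where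
  "compose_map S T = (\<lambda>u. psubst T (S u))"

(* The identity map is represented by the tuple pvar of the coordinates.  That the
   composites are not identically zero is part of same_rational_map. *)
definition inverse_map :: "('v \<Rightarrow> ('v, 'k::field) mpoly) \<Rightarrow> ('v \<Rightarrow> ('v, 'k) mpoly) \<Rightarrow> bool" where
  "inverse_map T S \<longleftrightarrow> rational_map T \<and> rational_map S \<and>
     same_rational_map (compose_map S T) pvar \<and> same_rational_map (compose_map T S) pvar"

definition cremona :: "('v \<Rightarrow> ('v, 'k::field) mpoly) \<Rightarrow> bool" where
  "cremona T \<longleftrightarrow> (\<exists>S. inverse_map T S)"


(* The tuple (x_1 f : ... : x_n f : g). *)
definition dj_map :: "('n option, 'k::field) mpoly \<Rightarrow> ('n option, 'k) mpoly
    \<Rightarrow> 'n option \<Rightarrow> ('n option, 'k) mpoly" where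
  "dj_map f g = (\<lambda>v. case v of Some j \<Rightarrow> pvar (Some j) * f | None \<Rightarrow> g)"

(* dj_map f g is a generalized de Jonquieres map of degree d with identity support. *)
definition generalized_de_jonquieres ::
    "nat \<Rightarrow> ('n option, 'k::field) mpoly \<Rightarrow> ('n option, 'k) mpoly \<Rightarrow> bool" where
  "generalized_de_jonquieres d f g \<longleftrightarrow>
     d \<ge> 2 \<and> cremona (dj_map f g) \<and>
     form (d - 1) f \<and> form d g \<and> gcd_one f g \<and>
     monoidal None f \<and> monoidal None g \<and> (involves None f \<or> involves None g)"


(* Bihomogeneous of bidegree (a, b) in (the x-variables, the y-variables). *)
definition biform :: "nat \<Rightarrow> nat \<Rightarrow> ('v, ('v, 'k::field) mpoly) mpoly \<Rightarrow> bool" where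
  "biform a b P \<longleftrightarrow> form b P \<and> (\<forall>m\<in>Poly_Mapping.keys P. form a (Poly_Mapping.lookup P m))"

(* The variable x_v and the variable y_v of R[y_1,...,y_{n+1}]. *)
abbreviation X :: "'v \<Rightarrow> ('v, ('v, 'k::field) mpoly) mpoly" where
  "X v \<equiv> pconst (pvar v)"

abbreviation Y :: "'v \<Rightarrow> ('v, ('v, 'k::field) mpoly) mpoly" where
  "Y v \<equiv> pvar v"

(* The ideal (x_1,...,x_n)^m of R[y_1,...,y_{n+1}], i.e. the ideal generated by all products
   of m of the variables x_1,...,x_n. *)
definition x_ideal_power :: "nat \<Rightarrow> ('n option, ('n option, 'k::field) mpoly) mpoly set" where
  "x_ideal_power m = module.span (*) {\<Prod>i<m. X (Some (s i)) | s. True}"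

(* F 0, ..., F (d - 2) is a fully downgraded sequence associated to dj_map f g; the values
   F i for i > d - 2 are irrelevant.

   On the sign in the inverse: each F i vanishes on the graph of the map, as F 0 does and
   the downgrading step only uses x_j y_l = x_l y_j for j, l in {1,...,n}.  So with
   F (d - 2) = a x_{n+1} + b_1 x_1 + ... + b_n x_n the inverse is
   (a y_1 : ... : a y_n : - (b_1 y_1 + ... + b_n y_n)), with a minus sign.  For example
   (x_1 x_3 : x_2 x_3 : x_1^2) has F 0 = x_3 y_3 - x_1 y_1 and
   inverse (y_3 y_1 : y_3 y_2 : y_1^2). *)
definition fully_downgraded ::
    "nat \<Rightarrow> ('n::finite option, 'k::field) mpoly \<Rightarrow> ('n option, 'k) mpoly
     \<Rightarrow> (nat \<Rightarrow> ('n option, ('n option, 'k) mpoly) mpoly) \<Rightarrow> bool" where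
  "fully_downgraded d f g F \<longleftrightarrow>
     (\<exists>q :: 'n \<Rightarrow> ('n option, 'k) mpoly.
        (\<forall>j. form (d - 1) (q j) \<and> monoidal None (q j)) \<and>
        g = (\<Sum>j\<in>UNIV. q j * pvar (Some j)) \<and>
        F 0 = pconst f * Y None - (\<Sum>j\<in>UNIV. pconst (q j) * Y (Some j))) \<and>
     (\<forall>i. i + 3 \<le> d \<longrightarrow>
        (\<exists>G :: 'n \<Rightarrow> ('n option, ('n option, 'k) mpoly) mpoly.
           (\<forall>j. biform (d - 2 - i) (i + 1) (G j) \<and> G j \<in> x_ideal_power (d - 3 - i)) \<and>
           F i = (\<Sum>j\<in>UNIV. G j * X (Some j)) \<and>
           F (i + 1) = (\<Sum>j\<in>UNIV. G j * Y (Some j))))"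

(* The partial derivative with respect to x_v on R[y_1,...,y_{n+1}], coefficientwise. *)
definition partial_x :: "'v \<Rightarrow> ('v, ('v, 'k::field) mpoly) mpoly \<Rightarrow> ('v, ('v, 'k) mpoly) mpoly" where
  "partial_x v P = Poly_Mapping.map (partial v) P"

(* The inclusion of k[y_1,...,y_{n+1}] into R[y_1,...,y_{n+1}]. *)
definition incl_y :: "('v, 'k::field) mpoly \<Rightarrow> ('v, ('v, 'k) mpoly) mpoly" where
  "incl_y p = Poly_Mapping.map pconst p"

end

theory Submission
  imports Defs
begin

text \<open>
  Write \<open>z\<close> for \<open>x\<^sub>n\<^sub>+\<^sub>1\<close>, \<open>w\<close> for \<open>y\<^sub>n\<^sub>+\<^sub>1\<close>, and \<open>f = f0 + f1 z\<close>, \<open>g = g0 + g1 z\<close>. Solving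
  \<open>w = g/f\<close> for \<open>z\<close> gives the inverse \<open>(y\<^sub>1 f' : \<dots> : y\<^sub>n f' : g')\<close> with
  \<open>f' = f1 w - g1\<close> and \<open>g' = g0 - f0 w\<close>; the composites are the identity times a power of
  \<open>f\<close> or \<open>f'\<close> and the determinant \<open>D = f1 g0 - f0 g1\<close>, which is nonzero because the map is
  birational. Substituting \<open>y\<^sub>j\<close> for \<open>x\<^sub>j\<close> (\<open>j \<le> n\<close>) turns each downgrading step into an equality,
  so it sends \<open>F\<^sub>d\<^sub>-\<^sub>2\<close> and \<open>F\<^sub>0\<close> to the same polynomial \<open>f w - g = f' z - g'\<close>; since \<open>F\<^sub>d\<^sub>-\<^sub>2\<close> is linear
  in \<open>x\<close>, its partial derivatives can be read off. A common factor of \<open>f'\<close> and \<open>g'\<close> free of \<open>w\<close>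
  divides \<open>f\<close> and \<open>g\<close>, while one of degree 1 in \<open>w\<close> would force \<open>D = 0\<close>; hence no unique
  factorization is needed.
\<close>

section \<open>Polynomials as sums of monomials\<close>

lemma poly_mapping_sum_single:
  fixes p :: "'m \<Rightarrow>\<^sub>0 'a::comm_monoid_add"
  shows "(\<Sum>m\<in>Poly_Mapping.keys p. Poly_Mapping.single m (Poly_Mapping.lookup p m)) = p"
proof (rule poly_mapping_eqI)
  fix k
  have "(\<Sum>m\<in>Poly_Mapping.keys p.
      Poly_Mapping.lookup (Poly_Mapping.single m (Poly_Mapping.lookup p m)) k) =
      (\<Sum>m\<in>Poly_Mapping.keys p. if m = k then Poly_Mapping.lookup p m else 0)"
    by (rule sum.cong) (auto simp: lookup_single when_def)
  then show "Poly_Mapping.lookup (\<Sum>m\<in>Poly_Mapping.keys p.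
      Poly_Mapping.single m (Poly_Mapping.lookup p m)) k = Poly_Mapping.lookup p k"
    by (simp add: lookup_sum in_keys_iff)
qed

text \<open>The summands in the \<open>add\<close> case may share monomials. Any additive property
  can therefore be checked on monomials alone, which is how multiplicativity of the evaluation maps
  is proved below.\<close>

lemma poly_mapping_add_induct [case_names single add]:
  fixes p :: "'m \<Rightarrow>\<^sub>0 'a::comm_monoid_add"
  assumes single: "\<And>m c. P (Poly_Mapping.single m c)"
    and add: "\<And>p q. P p \<Longrightarrow> P q \<Longrightarrow> P (p + q)"
  shows "P p"
proof -
  have "P (\<Sum>m\<in>A. Poly_Mapping.single m (Poly_Mapping.lookup p m))" if "finite A" for A
    using that
  proof (induction A rule: finite_induct)
    case empty
    have "P (Poly_Mapping.single undefined 0)" by (rule single)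
    then show ?case by simp
  next
    case (insert a A)
    then show ?case by (simp add: add single)
  qed
  from this[of "Poly_Mapping.keys p"] show ?thesis by (simp add: poly_mapping_sum_single)
qed

text \<open>Exponents cancel, so among the monomials of \<open>p\<close> only \<open>m\<close> is
  moved to \<open>m + k\<close>.\<close>

lemma lookup_mult_single_add:
  fixes p :: "'m::cancel_comm_monoid_add \<Rightarrow>\<^sub>0 'a::comm_semiring_1"
  shows "Poly_Mapping.lookup (p * Poly_Mapping.single k c) (m + k) = Poly_Mapping.lookup p m * c"
  by (induction p rule: poly_mapping_add_induct)
    (auto simp: mult_single lookup_single when_def distrib_right lookup_add)

lemma lookup_mult_single_zero:
  fixes p :: "'m::cancel_comm_monoid_add \<Rightarrow>\<^sub>0 'a::comm_semiring_1"
  shows "Poly_Mapping.lookup (p * Poly_Mapping.single 0 c) m = Poly_Mapping.lookup p m * c"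
  using lookup_mult_single_add[of p 0 c m] by simp

lemma keys_multE:
  assumes "m \<in> Poly_Mapping.keys (p * q)"
  obtains x y where "m = x + y" "x \<in> Poly_Mapping.keys p" "y \<in> Poly_Mapping.keys q"
  using assms keys_mult[of p q] by blast

lemma keys_add_nat:
  fixes a b :: "'v \<Rightarrow>\<^sub>0 nat"
  shows "Poly_Mapping.keys (a + b) = Poly_Mapping.keys a \<union> Poly_Mapping.keys b"
  by (auto simp: in_keys_iff lookup_add)

lemma mdeg_superset:
  assumes "finite A" "Poly_Mapping.keys m \<subseteq> A"
  shows "mdeg m = (\<Sum>v\<in>A. Poly_Mapping.lookup m v)"
  unfolding mdeg_def using assms by (intro sum.mono_neutral_left) (auto simp: in_keys_iff)

lemma mdeg_add: "mdeg (a + b) = mdeg a + mdeg b"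
proof -
  let ?A = "Poly_Mapping.keys a \<union> Poly_Mapping.keys b"
  have "mdeg (a + b) = (\<Sum>v\<in>?A. Poly_Mapping.lookup (a + b) v)"
    by (rule mdeg_superset) (auto simp: keys_add_nat)
  moreover have "mdeg a = (\<Sum>v\<in>?A. Poly_Mapping.lookup a v)" by (rule mdeg_superset) auto
  moreover have "mdeg b = (\<Sum>v\<in>?A. Poly_Mapping.lookup b v)" by (rule mdeg_superset) auto
  ultimately show ?thesis by (simp add: lookup_add sum.distrib)
qed

lemma mdeg_zero [simp]: "mdeg 0 = 0"
  by (simp add: mdeg_def)

lemma mdeg_single [simp]: "mdeg (Poly_Mapping.single v n) = n"
  by (simp add: mdeg_def)

lemma mdeg_eq_1_iff: "mdeg m = 1 \<longleftrightarrow> (\<exists>v. m = Poly_Mapping.single v 1)"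
proof
  assume 1: "mdeg m = 1"
  then have "Poly_Mapping.keys m \<noteq> {}" by (auto simp: mdeg_def)
  then obtain v where v: "v \<in> Poly_Mapping.keys m" by blast
  have "Poly_Mapping.lookup m v + (\<Sum>w\<in>Poly_Mapping.keys m - {v}. Poly_Mapping.lookup m w) = 1"
    using 1 v by (simp add: mdeg_def sum.remove[symmetric])
  moreover have "Poly_Mapping.lookup m v \<noteq> 0" using v by (simp add: in_keys_iff)
  ultimately have "Poly_Mapping.lookup m v = 1"
    and "(\<Sum>w\<in>Poly_Mapping.keys m - {v}. Poly_Mapping.lookup m w) = 0" by linarith+
  then have "m = Poly_Mapping.single v 1"
    by (intro poly_mapping_eqI) (auto simp: lookup_single when_def in_keys_iff)
  then show "\<exists>v. m = Poly_Mapping.single v 1" by blast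
qed auto

section \<open>Closure properties of forms\<close>

lemma form_zero [simp]: "form d 0"
  by (simp add: form_def)

lemma form_single: "mdeg m = d \<Longrightarrow> form d (Poly_Mapping.single m c)"
  by (simp add: form_def)

lemma form_pvar [simp]: "form 1 (pvar v)"
  by (simp add: pvar_def form_single)

lemma form_add: "form d p \<Longrightarrow> form d q \<Longrightarrow> form d (p + q)"
  unfolding form_def using keys_add[of p q] by blast

lemma form_uminus: "form d p \<Longrightarrow> form d (- p)"
  by (simp add: form_def in_keys_iff)

lemma form_diff: "form d p \<Longrightarrow> form d q \<Longrightarrow> form d (p - q)"
  using form_add[of d p "- q"] by (simp add: form_uminus)

lemma form_sum: "(\<And>i. i \<in> I \<Longrightarrow> form d (p i)) \<Longrightarrow> form d (sum p I)"
  by (induction I rule: infinite_finite_induct) (auto simp: form_add)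

lemma form_mult: "form a p \<Longrightarrow> form b q \<Longrightarrow> form (a + b) (p * q)"
  unfolding form_def
proof
  fix m assume pq: "\<forall>m\<in>Poly_Mapping.keys p. mdeg m = a" "\<forall>m\<in>Poly_Mapping.keys q. mdeg m = b"
    and "m \<in> Poly_Mapping.keys (p * q)"
  then obtain x y where "m = x + y" "x \<in> Poly_Mapping.keys p" "y \<in> Poly_Mapping.keys q"
    using keys_mult[of p q] by blast
  with pq show "mdeg m = a + b" by (simp add: mdeg_add)
qed

lemma form_one: "form 0 1"
  by (simp add: form_def)

lemma form_power: "form a p \<Longrightarrow> form (n * a) (p ^ n)"
  by (induction n) (auto simp: form_mult form_one)

section \<open>Polynomials free of a variable, or of degree at most 1 in it\<close>

lemma not_involves_zero: "\<not> involves v 0"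
  by (simp add: involves_def)

lemma not_involves_one: "\<not> involves v 1"
  by (simp add: involves_def)

lemma not_involves_single:
  "Poly_Mapping.lookup m v = 0 \<Longrightarrow> \<not> involves v (Poly_Mapping.single m c)"
  by (simp add: involves_def)

lemma not_involves_add: "\<not> involves v p \<Longrightarrow> \<not> involves v q \<Longrightarrow> \<not> involves v (p + q)"
  unfolding involves_def using keys_add[of p q] by blast

lemma not_involves_uminus: "\<not> involves v p \<Longrightarrow> \<not> involves v (- p)"
  by (simp add: involves_def in_keys_iff)

lemma not_involves_sum:
  "(\<And>i. i \<in> I \<Longrightarrow> \<not> involves v (p i)) \<Longrightarrow> \<not> involves v (sum p I)"
  by (induction I rule: infinite_finite_induct) (auto simp: not_involves_add not_involves_zero)

lemma not_involves_mult: "\<not> involves v p \<Longrightarrow> \<not> involves v q \<Longrightarrow> \<not> involves v (p * q)"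
  unfolding involves_def
proof
  assume pq: "\<not> (\<exists>m\<in>Poly_Mapping.keys p. Poly_Mapping.lookup m v \<noteq> 0)"
      "\<not> (\<exists>m\<in>Poly_Mapping.keys q. Poly_Mapping.lookup m v \<noteq> 0)"
    and "\<exists>m\<in>Poly_Mapping.keys (p * q). Poly_Mapping.lookup m v \<noteq> 0"
  then obtain m where "m \<in> Poly_Mapping.keys (p * q)" "Poly_Mapping.lookup m v \<noteq> 0" by blast
  moreover from this obtain x y where "m = x + y" "x \<in> Poly_Mapping.keys p" "y \<in> Poly_Mapping.keys q"
    using keys_mult[of p q] by blast
  ultimately show False using pq by (simp add: lookup_add)
qed

lemma not_involves_power: "\<not> involves v p \<Longrightarrow> \<not> involves v (p ^ n)"
  by (induction n) (auto simp: not_involves_one not_involves_mult)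

lemma not_involves_prod:
  "(\<And>i. i \<in> I \<Longrightarrow> \<not> involves v (p i)) \<Longrightarrow> \<not> involves v (prod p I)"
  by (induction I rule: infinite_finite_induct) (auto simp: not_involves_mult not_involves_one)

lemma not_involves_pvar: "v \<noteq> w \<Longrightarrow> \<not> involves v (pvar w)"
  by (simp add: pvar_def involves_def lookup_single)

lemma lookup_mult_pvar_add:
  "Poly_Mapping.lookup (p * pvar v) (m + Poly_Mapping.single v 1) = Poly_Mapping.lookup p m"
  by (simp add: pvar_def lookup_mult_single_add)

text \<open>Coefficients are compared at monomials \<open>m + single v 1\<close>. These are
  divisible by \<open>v\<close>, so \<open>p0\<close> and \<open>q0\<close> contribute nothing
  there. This is the tool for comparing coefficients with respect to \<open>v\<close> without
  passing to a univariate polynomial ring.\<close>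

lemma not_involves_linear_unique:
  assumes "p0 + p1 * pvar v = q0 + q1 * pvar v"
    and "\<not> involves v p0" "\<not> involves v p1" "\<not> involves v q0" "\<not> involves v q1"
  shows "p0 = q0 \<and> p1 = q1"
proof -
  have "p1 = q1"
  proof (rule poly_mapping_eqI)
    fix m
    let ?m = "m + Poly_Mapping.single v (1::nat)"
    have "Poly_Mapping.lookup r ?m = 0" if "\<not> involves v r" for r :: "('a, 'b) mpoly"
    proof (rule ccontr)
      assume "Poly_Mapping.lookup r ?m \<noteq> 0"
      then have "involves v r"
        unfolding involves_def by (intro bexI[of _ ?m]) (auto simp: in_keys_iff lookup_add)
      with that show False ..
    qed
    then show "Poly_Mapping.lookup p1 m = Poly_Mapping.lookup q1 m"
      using arg_cong[OF assms(1), of "\<lambda>r. Poly_Mapping.lookup r ?m"] assms(2-5)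
      by (simp add: lookup_add lookup_mult_pvar_add del: One_nat_def)
  qed
  with assms(1) show ?thesis by simp
qed

lemma not_involves_linear_eq_0:
  assumes "p0 + p1 * pvar v = 0" "\<not> involves v p0" "\<not> involves v p1"
  shows "p0 = 0 \<and> p1 = 0"
  using not_involves_linear_unique[of p0 p1 v 0 0] assms by (simp add: not_involves_zero)

text \<open>The monomials are sorted by their exponent of \<open>v\<close>, which is 0 or 1.
  Homogeneity is handed on for every degree because each part collects monomials of \<open>p\<close>
  itself, up to the removal of one \<open>v\<close>.\<close>

lemma monoidal_decompose:
  fixes p :: "('v, 'a::comm_ring_1) mpoly"
  assumes "monoidal v p"
  obtains p0 p1 where "\<not> involves v p0" "\<not> involves v p1" "p = p0 + p1 * pvar v"
    "\<And>d. form d p \<Longrightarrow> form d p0" "\<And>d. form d p \<Longrightarrow> form (d - 1) p1"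
proof -
  let ?e = "Poly_Mapping.single v (1::nat)"
  define K0 where "K0 = {m\<in>Poly_Mapping.keys p. Poly_Mapping.lookup m v = 0}"
  define K1 where "K1 = {m\<in>Poly_Mapping.keys p. Poly_Mapping.lookup m v = 1}"
  define p0 where "p0 = (\<Sum>m\<in>K0. Poly_Mapping.single m (Poly_Mapping.lookup p m))"
  define p1 where "p1 = (\<Sum>m\<in>K1. Poly_Mapping.single (m - ?e) (Poly_Mapping.lookup p m))"
  \<comment> \<open>Subtraction of exponents is truncated; it is exact here because the exponent of
    \<open>v\<close> in \<open>m\<close> is 1.\<close>
  have m: "m - ?e + ?e = m" if "m \<in> K1" for m
    using that by (intro poly_mapping_eqI)
      (auto simp: K1_def lookup_add lookup_minus lookup_single when_def)
  have K: "Poly_Mapping.keys p = K0 \<union> K1"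
  proof -
    have "Poly_Mapping.lookup m v = 0 \<or> Poly_Mapping.lookup m v = 1"
      if "m \<in> Poly_Mapping.keys p" for m
      using assms that by (force simp: monoidal_def le_Suc_eq)
    then show ?thesis by (auto simp: K0_def K1_def)
  qed
  have "p1 * pvar v = (\<Sum>m\<in>K1. Poly_Mapping.single m (Poly_Mapping.lookup p m))"
    unfolding p1_def sum_distrib_right
    by (rule sum.cong) (auto simp: pvar_def mult_single m[simplified])
  moreover have "p = (\<Sum>m\<in>K0 \<union> K1. Poly_Mapping.single m (Poly_Mapping.lookup p m))"
    using poly_mapping_sum_single[of p] by (simp add: K)
  moreover have "\<dots> = p0 + (\<Sum>m\<in>K1. Poly_Mapping.single m (Poly_Mapping.lookup p m))"
    unfolding p0_def by (rule sum.union_disjoint) (auto simp: K0_def K1_def)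
  ultimately have 1: "p = p0 + p1 * pvar v" by simp
  have 2: "\<not> involves v p0"
    unfolding p0_def by (auto intro!: not_involves_sum not_involves_single simp: K0_def)
  have 3: "\<not> involves v p1"
    unfolding p1_def
    by (auto intro!: not_involves_sum not_involves_single simp: K1_def lookup_minus)
  have 4: "form d p0" if "form d p" for d
    unfolding p0_def using that by (intro form_sum form_single) (auto simp: K0_def form_def)
  have 5: "form (d - 1) p1" if "form d p" for d
    unfolding p1_def
  proof (intro form_sum form_single)
    fix i assume i: "i \<in> K1"
    then have "mdeg i = d" using that by (auto simp: K1_def form_def)
    moreover have "mdeg (i - ?e) + 1 = mdeg i"
      using arg_cong[OF m[OF i], of mdeg] by (simp add: mdeg_add)
    ultimately show "mdeg (i - ?e) = d - 1" by simp
  qed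
  from that[OF 2 3 1 4 5] show thesis .
qed

section \<open>Leading monomials\<close>

text \<open>An injective additive weight \<open>w\<close> is a monomial order in disguise: the top
  weight of the product is reached only by the pair of top monomials.\<close>

lemma lookup_mult_leading:
  fixes w :: "'m::cancel_comm_monoid_add \<Rightarrow> 'o::linordered_cancel_ab_semigroup_add"
    and p q :: "'m \<Rightarrow>\<^sub>0 'a::comm_ring_1"
  assumes w_add: "\<And>a b. w (a + b) = w a + w b" and w_inj: "inj w"
    and a: "\<And>m. m \<in> Poly_Mapping.keys p \<Longrightarrow> w m \<le> w a"
    and b: "\<And>m. m \<in> Poly_Mapping.keys q \<Longrightarrow> w m \<le> w b"
  shows "Poly_Mapping.lookup (p * q) (a + b) = Poly_Mapping.lookup p a * Poly_Mapping.lookup q b"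
proof -
  define p' where "p' = p - Poly_Mapping.single a (Poly_Mapping.lookup p a)"
  define q' where "q' = q - Poly_Mapping.single b (Poly_Mapping.lookup q b)"
  have p': "w m < w a" if "m \<in> Poly_Mapping.keys p'" for m
  proof -
    have "m \<noteq> a" "m \<in> Poly_Mapping.keys p"
      using that by (auto simp: p'_def in_keys_iff lookup_minus lookup_single when_def split: if_splits)
    then show ?thesis using a[of m] inj_eq[OF w_inj, of m a] by simp
  qed
  have q': "w m < w b" if "m \<in> Poly_Mapping.keys q'" for m
  proof -
    have "m \<noteq> b" "m \<in> Poly_Mapping.keys q"
      using that by (auto simp: q'_def in_keys_iff lookup_minus lookup_single when_def split: if_splits)
    then show ?thesis using b[of m] inj_eq[OF w_inj, of m b] by simp
  qed
  \<comment> \<open>With the leading terms split off, each of the two remaining products involves a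
    factor whose monomials have strictly smaller weight, so neither can reach
    \<open>a + b\<close>.\<close>
  have "p * q = Poly_Mapping.single (a + b) (Poly_Mapping.lookup p a * Poly_Mapping.lookup q b)
      + Poly_Mapping.single a (Poly_Mapping.lookup p a) * q' + p' * q"
    by (simp add: mult_single[symmetric] p'_def q'_def algebra_simps)
  moreover have "a + b \<notin> Poly_Mapping.keys (Poly_Mapping.single a (Poly_Mapping.lookup p a) * q')"
  proof
    assume "a + b \<in> Poly_Mapping.keys (Poly_Mapping.single a (Poly_Mapping.lookup p a) * q')"
    then obtain m n where mn: "a + b = m + n" "m = a" "n \<in> Poly_Mapping.keys q'"
      using keys_mult[of "Poly_Mapping.single a (Poly_Mapping.lookup p a)" q']
      by (auto split: if_splits)
    then show False using q'[of n] by simp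
  qed
  moreover have "a + b \<notin> Poly_Mapping.keys (p' * q)"
  proof
    assume "a + b \<in> Poly_Mapping.keys (p' * q)"
    then obtain m n where mn: "a + b = m + n" "m \<in> Poly_Mapping.keys p'" "n \<in> Poly_Mapping.keys q"
      using keys_mult[of p' q] by auto
    then have "w m + w n < w a + w b" using p' b by (intro add_less_le_mono) auto
    then show False by (simp add: w_add[symmetric] mn(1)[symmetric])
  qed
  ultimately show ?thesis by (simp add: lookup_add in_keys_iff)
qed

text \<open>The leading monomials for an order that looks at \<open>v\<close> first also have the
  largest exponent of \<open>v\<close>. One statement thus yields both the absence of zero divisors
  and the additivity of the degree in \<open>v\<close>.\<close>

lemma mult_leading_exponent:
  fixes p q :: "('v::finite, 'k::field) mpoly"
  assumes "p \<noteq> 0" "q \<noteq> 0"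
  obtains a b where "a \<in> Poly_Mapping.keys p" "b \<in> Poly_Mapping.keys q"
    "a + b \<in> Poly_Mapping.keys (p * q)"
    "\<And>m. m \<in> Poly_Mapping.keys p \<Longrightarrow> Poly_Mapping.lookup m v \<le> Poly_Mapping.lookup a v"
    "\<And>m. m \<in> Poly_Mapping.keys q \<Longrightarrow> Poly_Mapping.lookup m v \<le> Poly_Mapping.lookup b v"
proof -
  obtain h :: "'v \<Rightarrow> nat" where h: "inj h"
    using finite_imp_inj_to_nat_seg[of "UNIV :: 'v set"] by auto
  \<comment> \<open>\<open>w\<close> encodes the lexicographic order for which \<open>v\<close> is the most significant variable.\<close>
  define \<iota> where "\<iota> u = (if u = v then 0 else Suc (h u))" for u
  have \<iota>: "\<iota> u = \<iota> u' \<longleftrightarrow> u = u'" for u u'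
    using h by (auto simp: \<iota>_def inj_def)
  define w :: "('v \<Rightarrow>\<^sub>0 nat) \<Rightarrow> (nat \<Rightarrow>\<^sub>0 nat)"
    where "w m = (\<Sum>u\<in>UNIV. Poly_Mapping.single (\<iota> u) (Poly_Mapping.lookup m u))" for m
  have w: "Poly_Mapping.lookup (w m) (\<iota> u) = Poly_Mapping.lookup m u" for m u
    by (simp add: w_def lookup_sum lookup_single \<iota> when_def)
  have w_add: "w (a + b) = w a + w b" for a b
    by (simp add: w_def lookup_add single_add sum.distrib)
  have w_inj: "inj w"
    by (rule injI, rule poly_mapping_eqI) (simp add: w[symmetric])
  \<comment> \<open>Two weights are compared at the smallest index where they differ, and index 0
    carries the exponent of \<open>v\<close>.\<close>
  have w_le: "Poly_Mapping.lookup m v \<le> Poly_Mapping.lookup a v" if "w m \<le> w a" for m a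
  proof (rule ccontr)
    assume "\<not> ?thesis"
    then have "Poly_Mapping.lookup (w a) 0 < Poly_Mapping.lookup (w m) 0"
      using w[of _ v] by (simp add: \<iota>_def)
    then have "w a < w m"
      by (auto simp: less_poly_mapping.rep_eq less_fun_def)
    with that show False by simp
  qed
  have ex: "\<exists>a\<in>Poly_Mapping.keys r. \<forall>m\<in>Poly_Mapping.keys r. w m \<le> w a"
    if "r \<noteq> 0" for r :: "('v, 'k) mpoly"
  proof -
    have "Poly_Mapping.keys r \<noteq> {}" using poly_mapping_sum_single[of r] that by auto
    then have ne: "w ` Poly_Mapping.keys r \<noteq> {}" by simp
    have "Max (w ` Poly_Mapping.keys r) \<in> w ` Poly_Mapping.keys r" using ne by (intro Max_in) auto
    then obtain a where "a \<in> Poly_Mapping.keys r" "w a = Max (w ` Poly_Mapping.keys r)" by auto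
    then show ?thesis by (auto intro!: bexI[of _ a])
  qed
  obtain a where a: "a \<in> Poly_Mapping.keys p" "\<And>m. m \<in> Poly_Mapping.keys p \<Longrightarrow> w m \<le> w a"
    using ex[OF assms(1)] by blast
  obtain b where b: "b \<in> Poly_Mapping.keys q" "\<And>m. m \<in> Poly_Mapping.keys q \<Longrightarrow> w m \<le> w b"
    using ex[OF assms(2)] by blast
  have "Poly_Mapping.lookup (p * q) (a + b) = Poly_Mapping.lookup p a * Poly_Mapping.lookup q b"
    by (rule lookup_mult_leading[OF w_add w_inj a(2) b(2)])
  with a(1) b(1) have "a + b \<in> Poly_Mapping.keys (p * q)" by (simp add: in_keys_iff)
  with a b w_le show thesis by (intro that[of a b]) simp_all
qed

section \<open>Absence of zero divisors and degrees of factors\<close>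

lemma mpoly_mult_eq_0_iff:
  fixes p q :: "('v::finite, 'k::field) mpoly"
  shows "p * q = 0 \<longleftrightarrow> p = 0 \<or> q = 0"
proof
  assume pq: "p * q = 0"
  show "p = 0 \<or> q = 0"
  proof (rule ccontr)
    assume "\<not> (p = 0 \<or> q = 0)"
    then have "p \<noteq> 0" "q \<noteq> 0" by auto
    then obtain a b where "a + b \<in> Poly_Mapping.keys (p * q)"
      by (rule mult_leading_exponent)
    with pq show False by simp
  qed
qed auto

lemma mpoly_mult_left_cancel:
  fixes p q r :: "('v::finite, 'k::field) mpoly"
  assumes "r \<noteq> 0" "r * p = r * q"
  shows "p = q"
  using mpoly_mult_eq_0_iff[of r "p - q"] assms by (simp add: algebra_simps)

lemma mpoly_power_eq_0_iff:
  fixes p :: "('v::finite, 'k::field) mpoly"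
  shows "p ^ n = 0 \<longleftrightarrow> n > 0 \<and> p = 0"
  by (induction n) (auto simp: mpoly_mult_eq_0_iff)

lemma pvar_neq_0: "(pvar v :: ('v, 'k::field) mpoly) \<noteq> 0"
proof
  assume "(pvar v :: ('v, 'k) mpoly) = 0"
  then have "Poly_Mapping.lookup (pvar v :: ('v, 'k) mpoly) (Poly_Mapping.single v 1) = 0" by simp
  then show False by (simp add: pvar_def)
qed

text \<open>Degrees in \<open>v\<close> add up over a field, so a product of degree at most 1 leaves
  at most one factor of positive degree.\<close>

lemma monoidal_mult_cases:
  fixes c a :: "('v::finite, 'k::field) mpoly"
  assumes "c \<noteq> 0" "a \<noteq> 0" "monoidal v (c * a)"
  shows "monoidal v c \<and> monoidal v a \<and> (\<not> involves v c \<or> \<not> involves v a)"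
proof -
  obtain m n where mn: "m + n \<in> Poly_Mapping.keys (c * a)"
    "\<And>k. k \<in> Poly_Mapping.keys c \<Longrightarrow> Poly_Mapping.lookup k v \<le> Poly_Mapping.lookup m v"
    "\<And>k. k \<in> Poly_Mapping.keys a \<Longrightarrow> Poly_Mapping.lookup k v \<le> Poly_Mapping.lookup n v"
    by (rule mult_leading_exponent[OF assms(1,2), of v]) (rule that)
  have "Poly_Mapping.lookup m v + Poly_Mapping.lookup n v \<le> 1"
    using bspec[OF assms(3)[unfolded monoidal_def] mn(1)] by (simp add: lookup_add)
  then have mn_le: "Poly_Mapping.lookup m v \<le> 1" "Poly_Mapping.lookup n v \<le> 1"
    and mn_0: "Poly_Mapping.lookup m v = 0 \<or> Poly_Mapping.lookup n v = 0" by linarith+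
  have "monoidal v c" unfolding monoidal_def using order_trans[OF mn(2) mn_le(1)] ..
  moreover have "monoidal v a" unfolding monoidal_def using order_trans[OF mn(3) mn_le(2)] ..
  moreover have "\<not> involves v c" if "Poly_Mapping.lookup m v = 0"
    using that mn(2) by (auto simp: involves_def)
  moreover have "\<not> involves v a" if "Poly_Mapping.lookup n v = 0"
    using that mn(3) by (auto simp: involves_def)
  ultimately show ?thesis using mn_0 by auto
qed

lemma monoidal_linear:
  fixes p0 p1 :: "('v, 'a::comm_ring_1) mpoly"
  assumes "\<not> involves v p0" "\<not> involves v p1"
  shows "monoidal v (p0 + p1 * pvar v)"
  unfolding monoidal_def
proof
  fix m assume "m \<in> Poly_Mapping.keys (p0 + p1 * pvar v)"
  then consider "m \<in> Poly_Mapping.keys p0" | "m \<in> Poly_Mapping.keys (p1 * pvar v)"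
    using keys_add[of p0 "p1 * pvar v"] by blast
  then show "Poly_Mapping.lookup m v \<le> 1"
  proof cases
    case 1
    with assms show ?thesis by (auto simp: involves_def)
  next
    case 2
    then obtain x y where xy: "m = x + y" "x \<in> Poly_Mapping.keys p1"
        "y \<in> Poly_Mapping.keys (pvar v :: ('v, 'a) mpoly)"
      by (rule keys_multE)
    have "y = Poly_Mapping.single v 1" using xy(3) by (simp add: pvar_def split: if_splits)
    with xy(1,2) assms show ?thesis by (auto simp: involves_def lookup_add)
  qed
qed

section \<open>Evaluation homomorphisms\<close>

text \<open>A common interface for the embedding of constants, substitutions, specialisations and
  the inclusion of k[y], all of which have to be pushed through sums and differences.\<close>

locale ring_morphism =
  fixes h :: "'a::comm_ring_1 \<Rightarrow> 'b::comm_ring_1"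
  assumes add: "h (x + y) = h x + h y"
    and mult: "h (x * y) = h x * h y"
    and one: "h 1 = 1"
begin

lemma zero: "h 0 = 0"
  using add[of 0 0] by simp

lemma uminus: "h (- x) = - h x"
  using add[of x "- x"] by (simp add: zero eq_neg_iff_add_eq_0 add.commute)

lemma diff: "h (x - y) = h x - h y"
  using add[of x "- y"] by (simp add: uminus)

lemma sum: "h (sum p I) = (\<Sum>i\<in>I. h (p i))"
  by (induction I rule: infinite_finite_induct) (auto simp: zero add)

end

lemma pconst_zero [simp]: "pconst 0 = 0"
  by (simp add: pconst_def)

lemma ring_morphism_pconst: "ring_morphism (pconst :: 'a::comm_ring_1 \<Rightarrow> ('v, 'a) mpoly)"
  by unfold_locales (simp_all add: pconst_def single_add mult_single)

lemma not_involves_pconst: "\<not> involves v (pconst c)"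
  by (simp add: pconst_def not_involves_single)

definition monom_eval :: "('v \<Rightarrow> 'b::comm_ring_1) \<Rightarrow> ('v \<Rightarrow>\<^sub>0 nat) \<Rightarrow> 'b" where
  "monom_eval T m = (\<Prod>v\<in>Poly_Mapping.keys m. T v ^ Poly_Mapping.lookup m v)"

lemma monom_eval_superset:
  assumes "finite A" "Poly_Mapping.keys m \<subseteq> A"
  shows "monom_eval T m = (\<Prod>v\<in>A. T v ^ Poly_Mapping.lookup m v)"
  unfolding monom_eval_def using assms by (intro prod.mono_neutral_left) (auto simp: in_keys_iff)

lemma monom_eval_add: "monom_eval T (a + b) = monom_eval T a * monom_eval T b"
proof -
  let ?A = "Poly_Mapping.keys a \<union> Poly_Mapping.keys b"
  have "monom_eval T (a + b) = (\<Prod>v\<in>?A. T v ^ Poly_Mapping.lookup (a + b) v)"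
    by (rule monom_eval_superset) (auto simp: keys_add_nat)
  moreover have "monom_eval T a = (\<Prod>v\<in>?A. T v ^ Poly_Mapping.lookup a v)"
    by (rule monom_eval_superset) auto
  moreover have "monom_eval T b = (\<Prod>v\<in>?A. T v ^ Poly_Mapping.lookup b v)"
    by (rule monom_eval_superset) auto
  ultimately show ?thesis by (simp add: lookup_add power_add prod.distrib)
qed

lemma monom_eval_zero [simp]: "monom_eval T 0 = 1"
  by (simp add: monom_eval_def)

lemma monom_eval_single [simp]: "monom_eval T (Poly_Mapping.single v n) = T v ^ n"
  by (simp add: monom_eval_def)

lemma monom_eval_scale: "monom_eval (\<lambda>v. c * T v) m = c ^ mdeg m * monom_eval T m"
  by (simp add: monom_eval_def mdeg_def power_mult_distrib prod.distrib power_sum)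

lemma monom_eval_pvar: "monom_eval pvar m = Poly_Mapping.single m 1"
proof -
  have pow: "pvar v ^ n = Poly_Mapping.single (Poly_Mapping.single v n) 1" for v :: 'a and n
    by (induction n) (auto simp: pvar_def mult_single single_add[symmetric])
  have "(\<Prod>v\<in>A. pvar v ^ k v) = Poly_Mapping.single (\<Sum>v\<in>A. Poly_Mapping.single v (k v)) 1"
    if "finite A" for A :: "'a set" and k
    using that by (induction A rule: finite_induct) (auto simp: pow mult_single)
  from this[of "Poly_Mapping.keys m" "Poly_Mapping.lookup m"] show ?thesis
    by (simp add: monom_eval_def poly_mapping_sum_single)
qed

text \<open>The coefficients are mapped as well. Taking \<open>pconst\<close> for \<open>h\<close>
  gives \<open>psubst\<close>; a substitution for \<open>h\<close> treats polynomials in y whose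
  coefficients are polynomials in x.\<close>

definition peval :: "('a::comm_ring_1 \<Rightarrow> 'b::comm_ring_1) \<Rightarrow> ('v \<Rightarrow> 'b) \<Rightarrow> ('v, 'a) mpoly \<Rightarrow> 'b" where
  "peval h T p = (\<Sum>m\<in>Poly_Mapping.keys p. h (Poly_Mapping.lookup p m) * monom_eval T m)"

lemma psubst_eq_peval: "psubst T = peval pconst T"
  by (intro ext) (simp add: psubst_def peval_def monom_eval_def)

context ring_morphism
begin

lemma peval_superset:
  assumes "finite A" "Poly_Mapping.keys p \<subseteq> A"
  shows "peval h T p = (\<Sum>m\<in>A. h (Poly_Mapping.lookup p m) * monom_eval T m)"
  unfolding peval_def using assms by (intro sum.mono_neutral_left) (auto simp: in_keys_iff zero)

lemma peval_single: "peval h T (Poly_Mapping.single m c) = h c * monom_eval T m"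
  using peval_superset[of "{m}"] by simp

lemma peval_add: "peval h T (p + q) = peval h T p + peval h T q"
proof -
  let ?A = "Poly_Mapping.keys p \<union> Poly_Mapping.keys q"
  have "peval h T (p + q) = (\<Sum>m\<in>?A. h (Poly_Mapping.lookup (p + q) m) * monom_eval T m)"
    using keys_add[of p q] by (intro peval_superset) auto
  moreover have "peval h T p = (\<Sum>m\<in>?A. h (Poly_Mapping.lookup p m) * monom_eval T m)"
    by (intro peval_superset) auto
  moreover have "peval h T q = (\<Sum>m\<in>?A. h (Poly_Mapping.lookup q m) * monom_eval T m)"
    by (intro peval_superset) auto
  ultimately show ?thesis by (simp add: lookup_add add distrib_right sum.distrib)
qed

lemma peval_mult: "peval h T (p * q) = peval h T p * peval h T q"
proof (induction p rule: poly_mapping_add_induct)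
  case (single m c)
  show ?case
    by (induction q rule: poly_mapping_add_induct)
      (auto simp: mult_single peval_single mult monom_eval_add peval_add distrib_left)
qed (simp add: distrib_right peval_add)

lemma ring_morphism_peval: "ring_morphism (peval h T)"
  using peval_single[of T 0 1] by unfold_locales (simp_all add: peval_add peval_mult one)

lemma peval_pconst: "peval h T (pconst c) = h c"
  by (simp add: pconst_def peval_single)

lemma peval_pvar: "peval h T (pvar v) = T v"
  by (simp add: pvar_def peval_single one)

end

lemma ring_morphism_psubst: "ring_morphism (psubst T)"
  unfolding psubst_eq_peval by (rule ring_morphism.ring_morphism_peval[OF ring_morphism_pconst])

lemmas psubst_mult = ring_morphism.mult[OF ring_morphism_psubst]
  and psubst_diff = ring_morphism.diff[OF ring_morphism_psubst]
  and psubst_one = ring_morphism.one[OF ring_morphism_psubst]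
  and psubst_pvar = ring_morphism.peval_pvar[OF ring_morphism_pconst, folded psubst_eq_peval]
  and psubst_pconst = ring_morphism.peval_pconst[OF ring_morphism_pconst, folded psubst_eq_peval]

lemma psubst_cong:
  assumes "\<And>v. involves v p \<Longrightarrow> T v = U v"
  shows "psubst T p = psubst U p"
  unfolding psubst_def
proof (intro sum.cong refl arg_cong2[where f = "(*)"] prod.cong)
  fix m v assume "m \<in> Poly_Mapping.keys p" "v \<in> Poly_Mapping.keys m"
  then have "involves v p" by (auto simp: involves_def in_keys_iff)
  then show "T v ^ Poly_Mapping.lookup m v = U v ^ Poly_Mapping.lookup m v" by (simp add: assms)
qed

lemma psubst_scale:
  assumes "form d p"
  shows "psubst (\<lambda>v. c * T v) p = c ^ d * psubst T p"
  using assms unfolding psubst_eq_peval peval_def sum_distrib_left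
  by (intro sum.cong refl) (simp add: monom_eval_scale form_def algebra_simps)

lemma psubst_pvar_id: "psubst pvar p = p"
  unfolding psubst_eq_peval peval_def
  by (simp add: monom_eval_pvar pconst_def mult_single poly_mapping_sum_single)

lemma not_involves_psubst:
  assumes "\<And>v. \<not> involves w (T v)"
  shows "\<not> involves w (psubst T p)"
  unfolding psubst_def using assms
  by (intro not_involves_sum not_involves_mult not_involves_pconst not_involves_prod
      not_involves_power)

text \<open>The value \<open>T None\<close> is never seen, since \<open>p\<close> is free of that
  variable. This applies to \<open>dj_map f g\<close> with \<open>c = f\<close>: its first
  coordinates are the variables times \<open>f\<close>.\<close>

lemma psubst_scale_pvar:
  assumes "form e p" "\<not> involves None p" "\<And>j. T (Some j) = c * pvar (Some j)"
  shows "psubst T p = c ^ e * p"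
proof -
  have "psubst T p = psubst (\<lambda>v. c * pvar v) p"
    using assms(2,3) by (intro psubst_cong) (metis option.exhaust)
  then show ?thesis by (simp add: psubst_scale[OF assms(1)] psubst_pvar_id)
qed

section \<open>Linear forms in the first set of variables\<close>

lemma single_Suc_0_eq_iff:
  "Poly_Mapping.single u (Suc 0) = Poly_Mapping.single v (Suc 0) \<longleftrightarrow> u = v"
  by (metis lookup_single_eq lookup_single_not_eq nat.distinct(1))

text \<open>The monomials of a linear form are single variables, so only that of \<open>v\<close>
  survives and its derivative is a constant.\<close>

lemma partial_form_1:
  assumes "form 1 p"
  shows "partial v p = pconst (Poly_Mapping.lookup p (Poly_Mapping.single v 1))"
proof -
  let ?e = "Poly_Mapping.single v (1::nat)"
  have "partial v p = (\<Sum>m\<in>Poly_Mapping.keys p. if m = ?e then pconst (Poly_Mapping.lookup p m) else 0)"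
    unfolding partial_def
  proof (rule sum.cong)
    fix m assume "m \<in> Poly_Mapping.keys p"
    then have "mdeg m = 1" using assms by (simp add: form_def)
    then obtain u where "m = Poly_Mapping.single u 1" unfolding mdeg_eq_1_iff by blast
    then show "Poly_Mapping.single (m - ?e)
        (of_nat (Poly_Mapping.lookup m v) * Poly_Mapping.lookup p m) =
        (if m = ?e then pconst (Poly_Mapping.lookup p m) else 0)"
      by (auto simp: pconst_def lookup_single when_def single_Suc_0_eq_iff)
  qed simp
  then show ?thesis by (simp add: in_keys_iff)
qed

lemma form_1_expand:
  fixes p :: "('v::finite, 'a::comm_ring_1) mpoly"
  assumes "form 1 p"
  shows "p = (\<Sum>v\<in>UNIV. pconst (Poly_Mapping.lookup p (Poly_Mapping.single v 1)) * pvar v)"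
proof (rule poly_mapping_eqI)
  fix m
  show "Poly_Mapping.lookup p m = Poly_Mapping.lookup
      (\<Sum>v\<in>UNIV. pconst (Poly_Mapping.lookup p (Poly_Mapping.single v 1)) * pvar v) m"
  proof (cases "mdeg m = 1")
    case True
    then obtain u where u: "m = Poly_Mapping.single u 1" unfolding mdeg_eq_1_iff by blast
    show ?thesis
      unfolding u lookup_sum pconst_def pvar_def mult_single
      by (simp add: lookup_single single_Suc_0_eq_iff when_def)
  next
    case False
    then have "Poly_Mapping.lookup p m = 0" using assms by (auto simp: form_def in_keys_iff)
    moreover have "m \<noteq> Poly_Mapping.single v 1" for v using False by auto
    ultimately show ?thesis
      unfolding lookup_sum pconst_def pvar_def mult_single
      by (auto simp: lookup_single when_def intro!: sum.neutral)
  qed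
qed

section \<open>The inclusion of k[y] and the coefficients of the x-variables\<close>

lemma lookup_map_zero:
  "h 0 = 0 \<Longrightarrow> Poly_Mapping.lookup (Poly_Mapping.map h p) m = h (Poly_Mapping.lookup p m)"
  by (simp add: Poly_Mapping.map.rep_eq when_def)

lemma lookup_incl_y: "Poly_Mapping.lookup (incl_y p) m = pconst (Poly_Mapping.lookup p m)"
  by (simp add: incl_y_def lookup_map_zero)

lemma lookup_partial_x: "Poly_Mapping.lookup (partial_x v P) m = partial v (Poly_Mapping.lookup P m)"
  unfolding partial_x_def by (rule lookup_map_zero) (simp add: partial_def)

lemma incl_y_single: "incl_y (Poly_Mapping.single m c) = Poly_Mapping.single m (pconst c)"
  by (simp add: incl_y_def)

lemma pconst_add: "pconst (a + b) = pconst a + pconst b"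
  by (simp add: pconst_def single_add)

lemma pconst_eq_0_iff: "pconst c = 0 \<longleftrightarrow> c = 0"
  by (metis lookup_single_eq lookup_zero pconst_def pconst_zero)

lemma ring_morphism_incl_y: "ring_morphism (incl_y :: ('v, 'k::field) mpoly \<Rightarrow> _)"
proof
  show add: "incl_y (p + q) = incl_y p + incl_y q" for p q :: "('v, 'k) mpoly"
    by (intro poly_mapping_eqI) (simp add: lookup_incl_y lookup_add pconst_add)
  show "incl_y (p * q) = incl_y p * incl_y q" for p q :: "('v, 'k) mpoly"
  proof (induction p rule: poly_mapping_add_induct)
    case (single m c)
    show ?case
      by (induction q rule: poly_mapping_add_induct)
        (auto simp: mult_single incl_y_single add distrib_left
          ring_morphism.mult[OF ring_morphism_pconst])
  qed (simp add: distrib_right add)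
  show "incl_y (1 :: ('v, 'k) mpoly) = 1"
    using incl_y_single[of "0 :: 'v \<Rightarrow>\<^sub>0 nat" "1 :: 'k"]
    by (simp add: pconst_def)
qed

lemma incl_y_pvar: "incl_y (pvar v) = Y v"
  by (simp add: pvar_def incl_y_single ring_morphism.one[OF ring_morphism_pconst])

lemma peval_incl_y:
  assumes h: "ring_morphism h" and "\<And>c. h (pconst c) = pconst c"
  shows "peval h pvar (incl_y p) = p"
proof -
  have "Poly_Mapping.keys (incl_y p) = Poly_Mapping.keys p"
    by (auto simp: in_keys_iff lookup_incl_y pconst_eq_0_iff)
  then have "peval h pvar (incl_y p) = psubst pvar p"
    by (simp add: peval_def psubst_eq_peval lookup_incl_y assms(2))
  then show ?thesis by (simp add: psubst_pvar_id)
qed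

text \<open>For \<open>P\<close> linear in the x-variables, the derivative in x_v contains no x.
  This is the polynomial of k[y] that it comes from under \<open>incl_y\<close>.\<close>

definition xcoeff :: "'v \<Rightarrow> ('v, ('v, 'k::field) mpoly) mpoly \<Rightarrow> ('v, 'k) mpoly" where
  "xcoeff v P = Poly_Mapping.map (\<lambda>r. Poly_Mapping.lookup r (Poly_Mapping.single v 1)) P"

lemma lookup_xcoeff:
  "Poly_Mapping.lookup (xcoeff v P) m =
    Poly_Mapping.lookup (Poly_Mapping.lookup P m) (Poly_Mapping.single v 1)"
  unfolding xcoeff_def by (rule lookup_map_zero) simp

text \<open>Since 0 is a form of every degree, the coefficient condition extends to monomials
  outside the support, which avoids tracking supports under sums.\<close>

lemma biform_altdef:
  "biform a b P \<longleftrightarrow> form b P \<and> (\<forall>m. form a (Poly_Mapping.lookup P m))"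
  unfolding biform_def by (metis form_zero not_in_keys_iff_lookup_eq_zero)

lemma incl_y_xcoeff:
  assumes "biform 1 b P"
  shows "incl_y (xcoeff v P) = partial_x v P"
  using assms
  by (intro poly_mapping_eqI)
    (simp only: biform_altdef lookup_incl_y lookup_xcoeff lookup_partial_x partial_form_1)

lemma biform_1_expand:
  fixes P :: "('v::finite, ('v, 'k::field) mpoly) mpoly"
  assumes "biform 1 b P"
  shows "P = (\<Sum>v\<in>UNIV. incl_y (xcoeff v P) * X v)"
proof (rule poly_mapping_eqI)
  fix m
  have "form 1 (Poly_Mapping.lookup P m)" using assms by (simp add: biform_altdef)
  then have "Poly_Mapping.lookup P m = (\<Sum>v\<in>UNIV. Poly_Mapping.lookup (incl_y (xcoeff v P)) m * pvar v)"
    unfolding lookup_incl_y lookup_xcoeff by (rule form_1_expand)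
  also have "\<dots> = Poly_Mapping.lookup (\<Sum>v\<in>UNIV. incl_y (xcoeff v P) * X v) m"
    unfolding lookup_sum by (simp add: pconst_def lookup_mult_single_zero)
  finally show "Poly_Mapping.lookup P m =
    Poly_Mapping.lookup (\<Sum>v\<in>UNIV. incl_y (xcoeff v P) * X v) m" .
qed

lemma biform_single: "mdeg m = b \<Longrightarrow> form a c \<Longrightarrow> biform a b (Poly_Mapping.single m c)"
  by (simp add: biform_altdef form_single lookup_single when_def)

lemma biform_diff: "biform a b P \<Longrightarrow> biform a b Q \<Longrightarrow> biform a b (P - Q)"
  by (simp add: biform_altdef form_diff lookup_minus)

lemma biform_sum: "(\<And>i. i \<in> I \<Longrightarrow> biform a b (P i)) \<Longrightarrow> biform a b (sum P I)"
  by (simp add: biform_altdef form_sum lookup_sum)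

lemma biform_mult_Y:
  assumes "biform a b P"
  shows "biform a (b + 1) (P * Y v)"
proof -
  have "P * Y v = (\<Sum>m\<in>Poly_Mapping.keys P.
      Poly_Mapping.single (m + Poly_Mapping.single v 1) (Poly_Mapping.lookup P m))"
    by (subst (1) poly_mapping_sum_single[of P, symmetric])
      (simp add: sum_distrib_right pvar_def mult_single)
  also have "biform a (b + 1) \<dots>"
    using assms by (intro biform_sum biform_single) (auto simp: biform_altdef form_def mdeg_add)
  finally show ?thesis .
qed

section \<open>Downgrading\<close>

text \<open>The specialisation \<open>x\<^sub>j \<mapsto> y\<^sub>j\<close>, \<open>x\<^sub>n\<^sub>+\<^sub>1 \<mapsto> c\<close> does not see the downgrading steps: they only trade \<open>x\<^sub>j\<close> for \<open>y\<^sub>j\<close>.\<close>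

definition xspec :: "'k::field \<Rightarrow> ('n option, 'k) mpoly \<Rightarrow> ('n option, 'k) mpoly" where
  "xspec c = psubst (\<lambda>v. case v of Some j \<Rightarrow> pvar (Some j) | None \<Rightarrow> pconst c)"

definition xyspec ::
    "'k::field \<Rightarrow> ('n option, ('n option, 'k) mpoly) mpoly \<Rightarrow> ('n option, 'k) mpoly" where
  "xyspec c = peval (xspec c) pvar"

lemma ring_morphism_xspec: "ring_morphism (xspec c)"
  unfolding xspec_def by (rule ring_morphism_psubst)

lemma ring_morphism_xyspec: "ring_morphism (xyspec c)"
  unfolding xyspec_def by (rule ring_morphism.ring_morphism_peval[OF ring_morphism_xspec])

lemma xyspec_pconst: "xyspec c (pconst p) = xspec c p"
  unfolding xyspec_def by (rule ring_morphism.peval_pconst[OF ring_morphism_xspec])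

lemma xyspec_Y: "xyspec c (Y v) = pvar v"
  unfolding xyspec_def by (rule ring_morphism.peval_pvar[OF ring_morphism_xspec])

lemma xspec_pvar:
  "xspec c (pvar (Some j)) = pvar (Some j)" "xspec c (pvar None) = pconst c"
  by (simp_all add: xspec_def psubst_pvar)

lemma xspec_linear:
  assumes "\<not> involves None p0" "\<not> involves None p1"
  shows "xspec c (p0 + p1 * pvar None) = p0 + p1 * pconst c"
proof -
  have "xspec c p = p" if "\<not> involves None p" for p :: "('a option, 'b) mpoly"
  proof -
    have "xspec c p = psubst pvar p"
      unfolding xspec_def using that by (intro psubst_cong) (auto split: option.split)
    then show ?thesis by (simp add: psubst_pvar_id)
  qed
  then show ?thesis
    using assms by (simp add: ring_morphism.add[OF ring_morphism_xspec]
        ring_morphism.mult[OF ring_morphism_xspec] xspec_pvar)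
qed

lemma xyspec_incl_y: "xyspec c (incl_y p) = p"
  unfolding xyspec_def
  by (rule peval_incl_y[OF ring_morphism_xspec]) (simp add: xspec_def psubst_pconst)

lemma sum_option_UNIV: "(\<Sum>v\<in>UNIV. h v) = h None + (\<Sum>j\<in>UNIV. h (Some (j::'n::finite)))"
  by (simp add: UNIV_option_conv sum.reindex)

text \<open>For \<open>F 0\<close>, the images of \<open>q j * y_j\<close> and
  \<open>q j * x_j\<close> agree, so the sum goes to the image of \<open>g\<close>. The bound on
  \<open>i\<close> says that all steps leading up to \<open>F i\<close> are available.\<close>

lemma xyspec_downgraded:
  assumes "fully_downgraded d f g F" "i + 2 \<le> d"
  shows "xyspec c (F i) = xspec c f * pvar None - xspec c g"
  using assms(2)
proof (induction i)
  case 0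
  obtain q where "g = (\<Sum>j\<in>UNIV. q j * pvar (Some j))"
    "F 0 = pconst f * Y None - (\<Sum>j\<in>UNIV. pconst (q j) * Y (Some j))"
    using assms(1) unfolding fully_downgraded_def by blast
  then show ?case
    by (simp add: ring_morphism.diff[OF ring_morphism_xyspec]
        ring_morphism.mult[OF ring_morphism_xyspec] ring_morphism.sum[OF ring_morphism_xyspec]
        ring_morphism.mult[OF ring_morphism_xspec] ring_morphism.sum[OF ring_morphism_xspec]
        xyspec_pconst xyspec_Y xspec_pvar)
next
  case (Suc i)
  then have "i + 3 \<le> d" by simp
  then obtain G where "F i = (\<Sum>j\<in>UNIV. G j * X (Some j))"
      "F (i + 1) = (\<Sum>j\<in>UNIV. G j * Y (Some j))"
    using assms(1) unfolding fully_downgraded_def by blast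
  then have "xyspec c (F (Suc i)) = xyspec c (F i)"
    by (simp add: ring_morphism.mult[OF ring_morphism_xyspec]
        ring_morphism.sum[OF ring_morphism_xyspec] xyspec_pconst xyspec_Y xspec_pvar)
  with Suc show ?case by simp
qed

lemma biform_last_downgraded:
  assumes "fully_downgraded d f g F" "form (d - 1) f" "d \<ge> 2"
  shows "biform 1 (d - 1) (F (d - 2))"
proof (cases "d = 2")
  case True
  obtain q where q: "\<And>j. form (d - 1) (q j)"
    "F 0 = pconst f * Y None - (\<Sum>j\<in>UNIV. pconst (q j) * Y (Some j))"
    using assms(1) unfolding fully_downgraded_def by blast
  have "biform 1 1 (pconst p * Y v)" if "form 1 p" for p :: "('a option, 'b) mpoly" and v
    using that by (simp add: pconst_def pvar_def mult_single biform_single)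
  with True q assms(2) show ?thesis by (auto intro!: biform_diff biform_sum)
next
  case False
  \<comment> \<open>This is the index of the last downgrading step, whose coefficients
    \<open>G j\<close> are already linear in x; multiplying by \<open>Y\<close> only raises the
    y-degree.\<close>
  define i where "i = d - 3"
  have i: "i + 3 \<le> d" "d - 2 = i + 1" "d - 2 - i = 1" "d - 1 = i + 1 + 1"
    using False assms(3) by (auto simp: i_def)
  then obtain G where G: "\<And>j. biform (d - 2 - i) (i + 1) (G j)"
      "F (i + 1) = (\<Sum>j\<in>UNIV. G j * Y (Some j))"
    using assms(1) unfolding fully_downgraded_def by blast
  have "biform 1 (i + 1) (G j)" for j
    using G(1)[of j] by (simp only: i(3))
  then show ?thesis
    unfolding i(2,4) G(2) by (intro biform_sum biform_mult_Y)
qed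

text \<open>After specialisation, \<open>F (d - 2)\<close> and \<open>F 0\<close> give the same
  expression, affine in the scalar \<open>c\<close>. The value 0 isolates the part without x_(n+1),
  and the value 1 then determines its coefficient.\<close>

lemma xcoeff_last_downgraded:
  assumes F: "fully_downgraded d f g F" and f: "form (d - 1) f" and d: "d \<ge> 2"
    and fg: "f = f0 + f1 * pvar None" "g = g0 + g1 * pvar None"
    and free: "\<not> involves None f0" "\<not> involves None f1" "\<not> involves None g0" "\<not> involves None g1"
  shows "xcoeff None (F (d - 2)) = f1 * pvar None - g1"
    and "(\<Sum>j\<in>UNIV. xcoeff (Some j) (F (d - 2)) * pvar (Some j)) = f0 * pvar None - g0"
proof -
  let ?P = "F (d - 2)" and ?b = "\<Sum>j\<in>UNIV. xcoeff (Some j) (F (d - 2)) * pvar (Some j)"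
  have spec: "xcoeff None ?P * pconst c + ?b = xspec c f * pvar None - xspec c g" for c
  proof -
    have "xyspec c ?P = xcoeff None ?P * pconst c + ?b"
      by (subst (1) biform_1_expand[OF biform_last_downgraded[OF F f d]])
        (simp add: ring_morphism.add[OF ring_morphism_xyspec]
          ring_morphism.mult[OF ring_morphism_xyspec] ring_morphism.sum[OF ring_morphism_xyspec]
          xyspec_incl_y xyspec_pconst xspec_pvar sum_option_UNIV)
    moreover have "xyspec c ?P = xspec c f * pvar None - xspec c g"
      using d by (intro xyspec_downgraded[OF F]) simp
    ultimately show ?thesis by simp
  qed
  show b: "?b = f0 * pvar None - g0"
    using spec[of 0] free by (simp add: fg xspec_linear)
  show "xcoeff None ?P = f1 * pvar None - g1"
    using spec[of 1, unfolded b] free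
    by (simp add: fg xspec_linear ring_morphism.one[OF ring_morphism_pconst] algebra_simps)
qed

section \<open>The two composites\<close>

lemma form_pvar_mult: "form d p \<Longrightarrow> form (Suc d) (pvar v * p)"
  using form_mult[OF form_pvar] by fastforce

lemma compose_dj_map:
  fixes f0 f1 g0 g1 :: "('n option, 'k::field) mpoly"
  assumes "form (e + 1) f0" "form e f1" "form (e + 2) g0" "form (e + 1) g1"
    and "\<not> involves None f0" "\<not> involves None f1" "\<not> involves None g0" "\<not> involves None g1"
    and f: "f = f0 + f1 * pvar None" and g: "g = g0 + g1 * pvar None"
    and f': "f' = f1 * pvar None - g1" and g': "g' = g0 - f0 * pvar None"
  shows "compose_map (dj_map f' g') (dj_map f g) =
    (\<lambda>v. pvar v * (f ^ (e + 1) * (f1 * g0 - f0 * g1)))"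
proof
  fix v :: "'n option"
  note hom = psubst_diff psubst_mult psubst_pvar
  have T: "dj_map f g (Some j) = f * pvar (Some j)" "dj_map f g None = g" for j
    by (simp_all add: dj_map_def)
  note scale = psubst_scale_pvar[where T = "dj_map f g", OF _ _ T(1)]
  \<comment> \<open>Scaling leaves \<open>f ^ e * (f1 * g - f * g1)\<close>; the products with
    \<open>pvar None\<close> cancel in the bracket, leaving the determinant.\<close>
  have f'T: "psubst (dj_map f g) f' = f ^ e * (f1 * g0 - f0 * g1)"
    unfolding f' hom T using assms(2,4,6,8)
    by (simp add: scale[of e f1] scale[of "e + 1" g1, simplified]) (simp add: f g algebra_simps)
  \<comment> \<open>Here the bracket is \<open>f * g0 - f0 * g\<close>, which is
    \<open>pvar None\<close> times the same determinant.\<close>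
  have g'T: "psubst (dj_map f g) g' = f ^ (e + 1) * pvar None * (f1 * g0 - f0 * g1)"
    unfolding g' hom T using assms(1,3,5,7)
    by (simp add: scale[of "e + 1" f0, simplified] scale[of "e + 2" g0, simplified])
      (simp add: f g algebra_simps)
  show "compose_map (dj_map f' g') (dj_map f g) v = pvar v * (f ^ (e + 1) * (f1 * g0 - f0 * g1))"
  proof (cases v)
    case None
    then show ?thesis by (simp add: compose_map_def dj_map_def[of f' g'] g'T algebra_simps)
  next
    case (Some j)
    then show ?thesis
      by (simp add: compose_map_def dj_map_def[of f' g'] hom T f'T algebra_simps)
  qed
qed

lemma same_rational_map_pvar:
  fixes H :: "('v::finite, 'k::field) mpoly"
  assumes "form d H" "H \<noteq> 0"
  shows "same_rational_map (\<lambda>v. pvar v * H) pvar"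
proof -
  have "rational_map (\<lambda>v. pvar v * H)"
    unfolding rational_map_def using form_pvar_mult[OF assms(1)] assms(2)
    by (auto simp: mpoly_mult_eq_0_iff pvar_neq_0)
  moreover have "rational_map (pvar :: 'v \<Rightarrow> ('v, 'k) mpoly)"
    unfolding rational_map_def
    by (intro conjI exI[of _ 1] exI[of _ undefined] allI form_pvar pvar_neq_0)
  ultimately show ?thesis by (simp add: same_rational_map_def algebra_simps)
qed

lemma rational_map_dj_map:
  fixes f g :: "('n::finite option, 'k::field) mpoly"
  assumes "form e f" "form (Suc e) g" "f \<noteq> 0"
  shows "rational_map (dj_map f g)"
proof -
  have "form (Suc e) (dj_map f g v)" for v
    using assms form_pvar_mult by (auto simp: dj_map_def split: option.split)
  moreover have "dj_map f g (Some undefined) \<noteq> 0"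
    using assms(3) by (simp add: dj_map_def mpoly_mult_eq_0_iff pvar_neq_0)
  ultimately show ?thesis unfolding rational_map_def by blast
qed

lemma inverse_map_dj_map:
  fixes f0 f1 g0 g1 :: "('n::finite option, 'k::field) mpoly"
  assumes forms: "form (e + 1) f0" "form e f1" "form (e + 2) g0" "form (e + 1) g1"
    and free: "\<not> involves None f0" "\<not> involves None f1" "\<not> involves None g0" "\<not> involves None g1"
    and f: "f = f0 + f1 * pvar None" and g: "g = g0 + g1 * pvar None"
    and f': "f' = f1 * pvar None - g1" and g': "g' = g0 - f0 * pvar None"
    and "f \<noteq> 0" "f' \<noteq> 0" and D: "f1 * g0 - f0 * g1 \<noteq> 0"
  shows "inverse_map (dj_map f g) (dj_map f' g')" "form (e + 1) f'" "form (e + 2) g'"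
proof -
  have z: "form (e + 1) (p * pvar None)" if "form e p" for e and p :: "('n option, 'k) mpoly"
    using form_mult[OF that form_pvar] .
  have f_form: "form (e + 1) f" unfolding f by (intro form_add z forms)
  have g_form: "form (e + 2) g" unfolding g using form_add[OF forms(3), of "g1 * pvar None"] z[OF forms(4)] by simp
  show f'_form: "form (e + 1) f'" unfolding f' by (intro form_diff z forms)
  show g'_form: "form (e + 2) g'" unfolding g' using form_diff[OF forms(3), of "f0 * pvar None"] z[OF forms(1)] by simp
  \<comment> \<open>The multiplier of the identity in a composite must itself be a form for the
    tuple to have one common degree.\<close>
  have D_form: "form (e + e + 2) (f1 * g0 - f0 * g1)"
    using form_diff[of "e + e + 2" "f1 * g0" "f0 * g1"]
      form_mult[OF forms(2,3)] form_mult[OF forms(1,4)] by (simp add: algebra_simps)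
  have same: "same_rational_map (\<lambda>v. pvar v * (h ^ (e + 1) * (f1 * g0 - f0 * g1))) pvar"
    if "form (e + 1) h" "h \<noteq> 0" for h :: "('n option, 'k) mpoly"
    by (rule same_rational_map_pvar[OF form_mult[OF form_power[OF that(1)] D_form]])
      (use that D in \<open>auto simp: mpoly_mult_eq_0_iff mpoly_power_eq_0_iff\<close>)
  have 1: "compose_map (dj_map f' g') (dj_map f g) =
      (\<lambda>v. pvar v * (f ^ (e + 1) * (f1 * g0 - f0 * g1)))"
    using assms by (intro compose_dj_map)
  \<comment> \<open>The construction is an involution: \<open>(f0, f1, g0, g1)\<close> is sent to \<open>(- g1, f1, g0, - f0)\<close>.\<close>
  have "compose_map (dj_map f g) (dj_map f' g') =
      (\<lambda>v. pvar v * (f' ^ (e + 1) * (f1 * g0 - (- g1) * (- f0))))"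
    using forms free
    by (intro compose_dj_map) (simp_all add: form_uminus not_involves_uminus f g f' g')
  then have 2: "compose_map (dj_map f g) (dj_map f' g') =
      (\<lambda>v. pvar v * (f' ^ (e + 1) * (f1 * g0 - f0 * g1)))"
    by (simp add: mult.commute)
  show "inverse_map (dj_map f g) (dj_map f' g')"
    unfolding inverse_map_def 1 2
    using same[OF f_form \<open>f \<noteq> 0\<close>] same[OF f'_form \<open>f' \<noteq> 0\<close>]
      rational_map_dj_map[of "e + 1" f g] rational_map_dj_map[of "e + 1" f' g']
      f_form g_form f'_form g'_form \<open>f \<noteq> 0\<close> \<open>f' \<noteq> 0\<close> by simp
qed

lemma inverse_map_sym: "inverse_map T S \<Longrightarrow> inverse_map S T"
  by (simp add: inverse_map_def)

section \<open>Nonvanishing of the determinant\<close>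

text \<open>If the determinant vanished, the map would be proportional to one that does not depend
  on \<open>x\<^sub>n\<^sub>+\<^sub>1\<close>, and such a map has no inverse.\<close>

lemma cremona_dj_map_det:
  fixes f0 f1 g0 g1 :: "('n::finite option, 'k::field) mpoly"
  assumes cremona: "cremona (dj_map f g)"
    and free: "\<not> involves None f0" "\<not> involves None f1" "\<not> involves None g0" "\<not> involves None g1"
    and f: "f = f0 + f1 * pvar None" and g: "g = g0 + g1 * pvar None"
    and "f \<noteq> 0" and involves: "involves None f \<or> involves None g"
  shows "f1 * g0 - f0 * g1 \<noteq> 0"
proof
  assume D: "f1 * g0 - f0 * g1 = 0"
  \<comment> \<open>With \<open>f1 = 0\<close> the relation would kill \<open>g1\<close> too, and
    neither \<open>f\<close> nor \<open>g\<close> would involve x_(n+1).\<close>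
  have f1: "f1 \<noteq> 0"
  proof
    assume "f1 = 0"
    then have "f0 * g1 = 0" "f = f0" using D f by auto
    then have "g1 = 0" using \<open>f \<noteq> 0\<close> by (simp add: mpoly_mult_eq_0_iff)
    then show False using involves f g free \<open>f1 = 0\<close> by simp
  qed
  define T where "T = dj_map f g"
  \<comment> \<open>The proportional tuple free of x_(n+1): the vanishing determinant says
    \<open>f1 * g = f * g1\<close>.\<close>
  define U where "U = dj_map f1 g1"
  have "f1 * g = f * g1" using D by (simp add: f g algebra_simps)
  then have "f1 * T v = f * U v" for v
    by (cases v) (simp_all add: T_def U_def dj_map_def mult.left_commute mult.commute)
  then have TU: "(\<lambda>v. f1 * T v) = (\<lambda>v. f * U v)" by blast
  have U: "\<not> involves None (U v)" for v
    using free by (auto simp: U_def dj_map_def not_involves_mult not_involves_pvar split: option.split)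
  obtain S where "inverse_map T S" using cremona unfolding cremona_def T_def by blast
  then have "rational_map S \<and> same_rational_map (compose_map S T) pvar"
    unfolding inverse_map_def by blast
  then have S: "rational_map S" "rational_map (compose_map S T)"
    "\<And>u v. psubst T (S u) * pvar v = psubst T (S v) * pvar u"
    unfolding same_rational_map_def compose_map_def by blast+
  obtain e where e: "\<And>u. form e (S u)" using S(1) unfolding rational_map_def by blast
  \<comment> \<open>Homogeneity of \<open>S\<close> turns the factors \<open>f1\<close> and
    \<open>f\<close> between the tuples into powers, so \<open>U\<close> inherits the
    proportionality to the identity from \<open>T\<close>.\<close>
  have scale: "f1 ^ e * psubst T (S u) = f ^ e * psubst U (S u)" for u
    unfolding psubst_scale[OF e, symmetric] TU ..
  have cross: "psubst U (S u) * pvar v = psubst U (S v) * pvar u" for u v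
  proof (rule mpoly_mult_left_cancel[of "f ^ e"])
    show "f ^ e \<noteq> 0" using \<open>f \<noteq> 0\<close> by (simp add: mpoly_power_eq_0_iff)
    have "f ^ e * (psubst U (S u) * pvar v) = f1 ^ e * (psubst T (S u) * pvar v)"
      by (simp only: mult.assoc[symmetric] scale)
    also have "\<dots> = f1 ^ e * (psubst T (S v) * pvar u)" by (rule arg_cong[OF S(3)])
    also have "\<dots> = f ^ e * (psubst U (S v) * pvar u)"
      by (simp only: mult.assoc[symmetric] scale)
    finally show "f ^ e * (psubst U (S u) * pvar v) = f ^ e * (psubst U (S v) * pvar u)" .
  qed
  have US: "\<not> involves None (psubst U (S v))" for v
    by (rule not_involves_psubst) (rule U)
  have Some: "psubst U (S (Some j)) = 0" for j
  proof -
    \<comment> \<open>The proportionality for \<open>None\<close> and \<open>Some j\<close> is a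
      vanishing polynomial of degree at most 1 in x_(n+1); its linear coefficient is the
      \<open>j\<close>-th component.\<close>
    let ?p = "- (psubst U (S None) * pvar (Some j))"
    have "\<not> involves None ?p"
      using US by (simp add: not_involves_uminus not_involves_mult not_involves_pvar)
    moreover have "?p + psubst U (S (Some j)) * pvar None = 0"
      using cross[of None "Some j"] by simp
    ultimately show ?thesis using not_involves_linear_eq_0[OF _ _ US] by blast
  qed
  then have None: "psubst U (S None) = 0"
    using cross[of None "Some undefined"] by (simp add: mpoly_mult_eq_0_iff pvar_neq_0)
  have "psubst U (S v) = 0" for v
    using Some None by (cases v) simp_all
  then have "psubst T (S v) = 0" for v
    using scale[of v] f1 by (simp add: mpoly_mult_eq_0_iff mpoly_power_eq_0_iff)
  then show False using S(2) by (simp add: rational_map_def compose_map_def)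
qed

section \<open>Coprimality of the inverse pair\<close>

lemma gcd_one_inverse:
  fixes f0 f1 g0 g1 :: "('n::finite option, 'k::field) mpoly"
  assumes gcd: "gcd_one (f0 + f1 * pvar None) (g0 + g1 * pvar None)"
    and free: "\<not> involves None f0" "\<not> involves None f1" "\<not> involves None g0" "\<not> involves None g1"
    and D: "f1 * g0 - f0 * g1 \<noteq> 0"
  shows "gcd_one (f1 * pvar None - g1) (g0 - f0 * pvar None)"
  unfolding gcd_one_def
proof (intro allI impI)
  fix c assume c: "c dvd f1 * pvar None - g1" "c dvd g0 - f0 * pvar None"
  from c(1) obtain a where "f1 * pvar None - g1 = c * a" ..
  then have a: "(- g1) + f1 * pvar None = c * a" by simp
  from c(2) obtain b where "g0 - f0 * pvar None = c * b" ..
  then have b: "g0 + (- f0) * pvar None = c * b" by simp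
  have free': "\<not> involves None (- g1)" "\<not> involves None (- f0)"
    using free by (simp_all add: not_involves_uminus)
  have ca: "monoidal None (c * a)" unfolding a[symmetric] using free free' by (intro monoidal_linear)
  have cb: "monoidal None (c * b)" unfolding b[symmetric] using free free' by (intro monoidal_linear)
  have c_neq_0: "c \<noteq> 0"
  proof
    assume "c = 0"
    then have "f1 = 0" "g1 = 0"
      using not_involves_linear_eq_0[of "- g1" f1 None] a free free' by auto
    with D show False by simp
  qed
  \<comment> \<open>One nonzero cofactor is enough to bound the degree of \<open>c\<close> in the
    last variable by 1.\<close>
  have ab: "a \<noteq> 0 \<or> b \<noteq> 0"
  proof (rule ccontr)
    assume "\<not> ?thesis"
    then have "f1 = 0" "g1 = 0"
      using not_involves_linear_eq_0[of "- g1" f1 None] a free free' by auto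
    with D show False by simp
  qed
  show "c dvd 1"
  proof (cases "involves None c")
    case False
    \<comment> \<open>The cofactor has degree at most 1 as well, and multiplying by the free
      \<open>c\<close> acts on both of its parts separately.\<close>
    have split: "c dvd p0 \<and> c dvd p1"
      if "p0 + p1 * pvar None = c * q" "\<not> involves None p0" "\<not> involves None p1" for p0 p1 q
    proof -
      have "monoidal None (c * q)" unfolding that(1)[symmetric] using that by (intro monoidal_linear)
      then have "monoidal None q"
        using monoidal_mult_cases[OF c_neq_0, of q] by (cases "q = 0") (auto simp: monoidal_def)
      then obtain q0 q1 where q: "\<not> involves None q0" "\<not> involves None q1" "q = q0 + q1 * pvar None"
        by (rule monoidal_decompose)
      have "p0 + p1 * pvar None = c * q0 + (c * q1) * pvar None"
        using that(1) by (simp add: q(3) algebra_simps)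
      then have "p0 = c * q0 \<and> p1 = c * q1"
        using that q False by (intro not_involves_linear_unique) (auto simp: not_involves_mult)
      then show ?thesis by simp
    qed
    have "c dvd g1" "c dvd f1" "c dvd g0" "c dvd f0"
      using split[OF a] split[OF b] free free' by simp_all
    then have "c dvd f0 + f1 * pvar None" "c dvd g0 + g1 * pvar None" by simp_all
    with gcd show ?thesis by (simp add: gcd_one_def)
  next
    case True
    have "monoidal None c"
      using ab monoidal_mult_cases[OF c_neq_0 _ ca] monoidal_mult_cases[OF c_neq_0 _ cb] by auto
    then obtain c0 c1 where c01: "\<not> involves None c0" "\<not> involves None c1" "c = c0 + c1 * pvar None"
      by (rule monoidal_decompose)
    \<comment> \<open>The factor \<open>c\<close> already uses up the one available degree, so both
      cofactors are free of the last variable.\<close>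
    have a_free: "\<not> involves None a"
      using True monoidal_mult_cases[OF c_neq_0 _ ca] by (cases "a = 0") (auto simp: not_involves_zero)
    have b_free: "\<not> involves None b"
      using True monoidal_mult_cases[OF c_neq_0 _ cb] by (cases "b = 0") (auto simp: not_involves_zero)
    have "(- g1) + f1 * pvar None = c0 * a + (c1 * a) * pvar None"
      using a by (simp add: c01(3) algebra_simps)
    then have "- g1 = c0 * a \<and> f1 = c1 * a"
      using free free' c01 a_free by (intro not_involves_linear_unique) (auto simp: not_involves_mult)
    moreover have "g0 + (- f0) * pvar None = c0 * b + (c1 * b) * pvar None"
      using b by (simp add: c01(3) algebra_simps)
    then have "g0 = c0 * b \<and> - f0 = c1 * b"
      using free free' c01 b_free by (intro not_involves_linear_unique) (auto simp: not_involves_mult)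
    \<comment> \<open>The coefficient pairs of both forms are multiples of \<open>(c0, c1)\<close>,
      so their determinant vanishes.\<close>
    ultimately have "f1 * g0 - (- f0) * (- g1) = (c1 * a) * (c0 * b) - (c1 * b) * (c0 * a)"
      by (simp only:)
    then have "f1 * g0 - f0 * g1 = 0" by (simp add: mult_ac)
    with D show ?thesis ..
  qed
qed

text \<open>Every divisor of \<open>g\<close> divides 0, so coprimality would make \<open>g\<close>
  a unit; but a form of positive degree vanishes at the origin.\<close>

lemma not_gcd_one_zero:
  fixes g :: "('v, 'k::field) mpoly"
  assumes "form d g" "d > 0"
  shows "\<not> gcd_one 0 g"
proof
  assume "gcd_one 0 g"
  then have "g dvd 1" unfolding gcd_one_def by simp
  then obtain k where k: "1 = g * k" by (elim dvdE)
  \<comment> \<open>Evaluation at the origin, written as scaling by 0 so that homogeneity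
    applies.\<close>
  have "psubst (\<lambda>v. 0 * (pvar v :: ('v, 'k) mpoly)) g = 0 ^ d * psubst pvar g"
    by (rule psubst_scale[OF assms(1)])
  then have "psubst (\<lambda>v. 0 * (pvar v :: ('v, 'k) mpoly)) (g * k) = 0"
    unfolding psubst_mult using assms(2) by (simp add: zero_power)
  then show False unfolding k[symmetric] psubst_one by simp
qed

section \<open>Reading the inverse off the last downgraded form\<close>

theorem proposition2p5:
  fixes f g :: "('n::finite option, 'k::field) mpoly"
    and F :: "nat \<Rightarrow> ('n option, ('n option, 'k) mpoly) mpoly"
    and d :: nat
  assumes "infinite (UNIV :: 'k set)"
    and "CARD('n) \<ge> 2"
    and "d \<ge> 2"
    and "generalized_de_jonquieres d f g"
    and "fully_downgraded d f g F"
  shows "\<exists>f' g' :: ('n option, 'k) mpoly.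
           incl_y f' = partial_x None (F (d - 2)) \<and>
           incl_y g' = - (\<Sum>j\<in>UNIV. partial_x (Some j) (F (d - 2)) * Y (Some j)) \<and>
           inverse_map (dj_map f g) (dj_map f' g') \<and>
           generalized_de_jonquieres d f' g'"
proof -
  have f_form: "form (d - 1) f" and g_form: "form d g" and cremona: "cremona (dj_map f g)"
    and gcd: "gcd_one f g" and mono: "monoidal None f" "monoidal None g"
    and involves: "involves None f \<or> involves None g"
    using assms(4) unfolding generalized_de_jonquieres_def by auto
  obtain f0 f1 where f0: "\<not> involves None f0" "\<not> involves None f1" "f = f0 + f1 * pvar None"
      "\<And>d. form d f \<Longrightarrow> form d f0" "\<And>d. form d f \<Longrightarrow> form (d - 1) f1"
    by (rule monoidal_decompose[OF mono(1)]) (rule that)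
  obtain g0 g1 where g0: "\<not> involves None g0" "\<not> involves None g1" "g = g0 + g1 * pvar None"
      "\<And>d. form d g \<Longrightarrow> form d g0" "\<And>d. form d g \<Longrightarrow> form (d - 1) g1"
    by (rule monoidal_decompose[OF mono(2)]) (rule that)
  define f' where "f' = f1 * pvar None - g1"
  define g' where "g' = g0 - f0 * pvar None"
  note free = f0(1,2) g0(1,2)
  have free': "\<not> involves None (- g1)" "\<not> involves None (- f0)"
    using free by (simp_all add: not_involves_uminus)
  have f'_alt: "f' = (- g1) + f1 * pvar None" and g'_alt: "g' = g0 + (- f0) * pvar None"
    by (simp_all add: f'_def g'_def)
  have f_neq_0: "f \<noteq> 0" using not_gcd_one_zero[OF g_form] gcd assms(3) by auto
  have D: "f1 * g0 - f0 * g1 \<noteq> 0"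
    using cremona_dj_map_det[OF cremona free f0(3) g0(3) f_neq_0 involves] .
  have f'_neq_0: "f' \<noteq> 0"
  proof
    assume "f' = 0"
    then have "f1 = 0" "g1 = 0"
      using not_involves_linear_eq_0[of "- g1" f1 None] free free' by (auto simp: f'_alt)
    with D show False by simp
  qed
  \<comment> \<open>All degrees are expressed through \<open>e\<close>, so that no truncated
    subtraction remains.\<close>
  obtain e where d: "d = e + 2" using assms(3) by (metis add.commute le_iff_add)
  have forms: "form (e + 1) f0" "form e f1" "form (e + 2) g0" "form (e + 1) g1"
    using f0(4,5)[OF f_form] g0(4,5)[OF g_form] by (simp_all add: d)
  note inv = inverse_map_dj_map[OF forms free f0(3) g0(3) f'_def g'_def f_neq_0 f'_neq_0 D]
  have biform: "biform 1 (d - 1) (F (d - 2))"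
    by (rule biform_last_downgraded[OF assms(5) f_form assms(3)])
  note xcoeff = xcoeff_last_downgraded[OF assms(5) f_form assms(3) f0(3) g0(3) free]
  have "incl_y f' = partial_x None (F (d - 2))"
    by (simp add: f'_def xcoeff(1)[symmetric] incl_y_xcoeff[OF biform])
  moreover have "incl_y g' = - (\<Sum>j\<in>UNIV. partial_x (Some j) (F (d - 2)) * Y (Some j))"
  proof -
    \<comment> \<open>The minus sign enters here: the sum equals \<open>f0 * pvar None - g0\<close>,
      the negative of \<open>g'\<close>.\<close>
    have "g' = - (\<Sum>j\<in>UNIV. xcoeff (Some j) (F (d - 2)) * pvar (Some j))"
      by (simp add: g'_def xcoeff(2))
    then show ?thesis
      by (simp add: ring_morphism.uminus[OF ring_morphism_incl_y]
          ring_morphism.sum[OF ring_morphism_incl_y] ring_morphism.mult[OF ring_morphism_incl_y]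
          incl_y_pvar incl_y_xcoeff[OF biform])
  qed
  moreover have "generalized_de_jonquieres d f' g'"
    unfolding generalized_de_jonquieres_def
  proof (intro conjI)
    show "cremona (dj_map f' g')"
      unfolding cremona_def using inverse_map_sym[OF inv(1)] by blast
    show "form (d - 1) f'" "form d g'" using inv(2,3) by (simp_all add: d)
    show "gcd_one f' g'"
      unfolding f'_def g'_def using gcd free D unfolding f0(3) g0(3) by (rule gcd_one_inverse)
    show "monoidal None f'" unfolding f'_alt using free free' by (intro monoidal_linear)
    show "monoidal None g'" unfolding g'_alt using free free' by (intro monoidal_linear)
    show "involves None f' \<or> involves None g'"
    proof (rule ccontr)
      assume "\<not> ?thesis"
      \<comment> \<open>The coefficients of \<open>pvar None\<close> in \<open>f'\<close> and
        \<open>g'\<close> are \<open>f1\<close> and \<open>- f0\<close>; if both vanish, so does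
        \<open>f\<close>.\<close>
      then have "f1 = 0" "- f0 = 0"
        using not_involves_linear_unique[of "- g1" f1 None f' 0]
          not_involves_linear_unique[of g0 "- f0" None g' 0] free free' f'_alt g'_alt
        by (auto simp: not_involves_zero)
      with f_neq_0 f0(3) show False by simp
    qed
  qed (rule assms(3))
  ultimately show ?thesis using inv(1) by blast
qed

end
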